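(* Let $\Phi$ be a (non-empty) set of target functions, and assume that $0\le\alpha(\Phi)<1$. Then $\Phi$ is compatible with respect to the fault-tolerant $(n,1)$-convergence problem to a point (FC(1)-PO).
   Context: Robot model. Robots $r_1,\dots,r_n$ are points in the plane $\mathbb{R}^2$, which carries a fixed right-handed global coordinate system $Z_0$. Time is discrete, $t=0,1,2,\dots$; $\mathbf{x}_t(r_i)$ is the position of $r_i$ at time $t$ in $Z_0$, and the configuration at $t$ is the multiset $P_t=\{\mathbf{x}_t(r_i):1\le i\le n\}$. Robot $r_i$ has a local coordinate system $Z_i$, right-handed, with its own unit length and axis directions (arbitrary, fixed over time), whose origin is always the current position of $r_i$; $\gamma_i$ denotes the coordinate transformation from $Z_i$ to $Z_0$ (an orientation-preserving similarity with $\gamma_i((0,0))=\mathbf{x}_t(r_i)$ at time $t$). A target function $\phi$ assigns to every multiset $P$ of $n$ points of $\mathbb{R}^2$ (for every $n\ge1$) an element of $\mathbb{R}^2\cup\{\bot\}$, with $\phi(P)=\bot$ if and only if $(0,0)\notin P$. Each robot $r_i$ is assigned a target function $\phi_i$. The scheduler is semi-synchronous: at each time $t$ an arbitrary subset of robots is activated; if a non-crashed $r_i$ is activated at $t$ then $\mathbf{x}_{t+1}(r_i)=\gamma_i(\phi_i(\gamma_i^{-1}(P_t)))$, otherwise $\mathbf{x}_{t+1}(r_i)=\mathbf{x}_t(r_i)$. The schedule is fair: every robot is activated infinitely often. A faulty robot may crash at an arbitrary time, after which it never moves again; crashed robots cannot be distinguished from other robots. The sequence $P_0,P_1,\dots$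 is an execution. Scale. $CH(P)$ is the convex hull of $P$, $g(P)=\frac1n\sum_{\mathbf{x}\in P}\mathbf{x}$ (with multiplicity), and $d*CH(P)=\{d\mathbf{x}+(1-d)g(P):\mathbf{x}\in CH(P)\}$ for $d\ge0$. $\alpha(\phi,P)$ is the smallest $d\ge 0$ with $\phi(P)\in d*CH(P)$ (and $0$ if $\phi(P)=\bot$; $\infty$ if there is no such $d$). $\alpha(\phi)=\sup_P\alpha(\phi,P)$ and $\alpha(\Phi)=\sup_{\phi\in\Phi}\alpha(\phi)$. Compatibility. $\Phi$ is compatible with respect to FC(1)-PO if, for every number $n\ge2$ of robots, every assignment of target functions from $\Phi$ to the robots (different robots may get different ones), every choice of local coordinate systems, every initial configuration, every fair schedule and every pattern of crashes in which at most one robot is faulty, all robots (including a faulty one) converge to one common point as $t\to\infty$. *)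

theory Defs
  imports "HOL-Analysis.Analysis"
begin

section \<open>Target functions and their scale\<close>

type_synonym point = "real ^ 2"

text \<open>\<open>None\<close> stands for \<open>\<bottom>\<close>. Target functions are defined on multisets of \<open>n \<ge> 1\<close> points;
  the value at the empty multiset is junk and is ignored everywhere below.\<close>

type_synonym target = "point multiset \<Rightarrow> point option"

definition target_function :: "target \<Rightarrow> bool" where
  "target_function \<phi> \<longleftrightarrow> (\<forall>P. P \<noteq> {#} \<longrightarrow> (\<phi> P = None \<longleftrightarrow> 0 \<notin># P))"

definition CH :: "point multiset \<Rightarrow> point set" where
  "CH P = convex hull (set_mset P)"

definition centroid :: "point multiset \<Rightarrow> point" where
  "centroid P = (1 / real (size P)) *\<^sub>R (\<Sum>\<^sub># P)"

definition scaled_CH :: "real \<Rightarrow> point multiset \<Rightarrow> point set" where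
  "scaled_CH d P = (\<lambda>x. d *\<^sub>R x + (1 - d) *\<^sub>R centroid P) ` CH P"

text \<open>The \<open>LEAST\<close> over the reals is justified by the lemma \<open>scale_at_attained\<close> below.\<close>

definition scale_at :: "target \<Rightarrow> point multiset \<Rightarrow> ereal" where
  "scale_at \<phi> P =
     (case \<phi> P of
        None \<Rightarrow> 0
      | Some y \<Rightarrow>
          if \<exists>d\<ge>0. y \<in> scaled_CH d P
          then ereal (LEAST d. 0 \<le> d \<and> y \<in> scaled_CH d P)
          else \<infinity>)"

definition scale :: "target \<Rightarrow> ereal" where
  "scale \<phi> = (SUP P\<in>{P. P \<noteq> {#}}. scale_at \<phi> P)"

definition scale_set :: "target set \<Rightarrow> ereal" where
  "scale_set \<Phi> = (SUP \<phi>\<in>\<Phi>. scale \<phi>)"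

lemma scaled_CH_least_exists:
  assumes "d0 \<ge> 0" "y \<in> scaled_CH d0 P"
  shows "\<exists>d. (0 \<le> d \<and> y \<in> scaled_CH d P) \<and> (\<forall>e. 0 \<le> e \<and> y \<in> scaled_CH e P \<longrightarrow> d \<le> e)"
proof -
  define K where "K = ({0..d0} \<times> CH P) \<inter>
    {p. fst p *\<^sub>R snd p + (1 - fst p) *\<^sub>R centroid P = y}"
  have "compact (CH P)"
    unfolding CH_def by (intro compact_convex_hull finite_imp_compact) simp
  moreover have "closed {p::real \<times> point. fst p *\<^sub>R snd p + (1 - fst p) *\<^sub>R centroid P = y}"
    by (intro closed_Collect_eq continuous_intros)
  ultimately have "compact K"
    unfolding K_def by (intro compact_Int_closed compact_Times compact_Icc)
  then have cmp: "compact (fst ` K)"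
    using compact_continuous_image[OF continuous_on_fst[OF continuous_on_id]] by blast
  have K: "d \<in> fst ` K \<longleftrightarrow> 0 \<le> d \<and> d \<le> d0 \<and> y \<in> scaled_CH d P" for d
  proof -
    have "d \<in> fst ` K \<longleftrightarrow> (\<exists>x. (d, x) \<in> K)" by (simp add: fst_eq_Domain Domain_iff)
    also have "\<dots> \<longleftrightarrow> 0 \<le> d \<and> d \<le> d0 \<and> (\<exists>x\<in>CH P. y = d *\<^sub>R x + (1 - d) *\<^sub>R centroid P)"
      unfolding K_def by (simp, metis)
    finally show ?thesis unfolding scaled_CH_def image_iff .
  qed
  have "d0 \<in> fst ` K" using assms K by simp
  then obtain d where d: "d \<in> fst ` K" "\<forall>e\<in>fst ` K. d \<le> e"
    using compact_attains_inf[OF cmp] by blast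
  have "d \<le> e" if "0 \<le> e" "y \<in> scaled_CH e P" for e
  proof (cases "e \<le> d0")
    case True
    then show ?thesis using that d(2) K[of e] by blast
  next
    case False
    then show ?thesis using d(1) K[of d] by linarith
  qed
  then show ?thesis using d(1) K by blast
qed

lemma scale_at_attained:
  assumes "\<phi> P = Some y" "d0 \<ge> 0" "y \<in> scaled_CH d0 P"
  shows "\<exists>d. scale_at \<phi> P = ereal d \<and> 0 \<le> d \<and> y \<in> scaled_CH d P \<and>
             (\<forall>e. 0 \<le> e \<and> y \<in> scaled_CH e P \<longrightarrow> d \<le> e)"
proof -
  obtain d where d: "0 \<le> d \<and> y \<in> scaled_CH d P"
      "\<forall>e. 0 \<le> e \<and> y \<in> scaled_CH e P \<longrightarrow> d \<le> e"
    using scaled_CH_least_exists[OF assms(2,3)] by blast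
  then have "(LEAST d. 0 \<le> d \<and> y \<in> scaled_CH d P) = d"
    by (intro Least_equality) auto
  then have "scale_at \<phi> P = ereal d"
    using assms by (auto simp: scale_at_def)
  with d show ?thesis by blast
qed


section \<open>Robots\<close>

definition configuration :: "nat \<Rightarrow> (nat \<Rightarrow> point) \<Rightarrow> point multiset" where
  "configuration n x = image_mset x (mset_set {..<n})"

text \<open>The coordinate transformation from a local to the global system: \<open>p\<close> is the current position
  of the robot, \<open>u\<close> its unit length, and the columns of \<open>A\<close> are its axis directions.\<close>

definition to_global :: "point \<Rightarrow> real \<Rightarrow> real ^ 2 ^ 2 \<Rightarrow> point \<Rightarrow> point" where
  "to_global p u A z = p + u *\<^sub>R (A *v z)"

lemma bij_to_global:
  assumes "u > 0" "rotation_matrix A"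
  shows "bij (to_global p u A)"
proof (rule o_bij)
  have A: "transpose A ** A = mat 1" "A ** transpose A = mat 1"
    using assms(2) by (auto simp: rotation_matrix_def orthogonal_matrix_def)
  have "(1 / u) *\<^sub>R (transpose A *v (to_global p u A z - p)) = z" for z
    using assms(1) A(1)
    by (simp only: to_global_def add_diff_cancel_left' matrix_vector_mult_scaleR
        matrix_vector_mul_assoc) simp
  then show "(\<lambda>w. (1 / u) *\<^sub>R (transpose A *v (w - p))) \<circ> to_global p u A = id"
    by (simp only: fun_eq_iff comp_apply id_apply) simp
  have "to_global p u A ((1 / u) *\<^sub>R (transpose A *v (w - p))) = w" for w
    using assms(1) A(2)
    by (simp only: to_global_def matrix_vector_mult_scaleR matrix_vector_mul_assoc) simp
  then show "to_global p u A \<circ> (\<lambda>w. (1 / u) *\<^sub>R (transpose A *v (w - p))) = id"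
    by (simp only: fun_eq_iff comp_apply id_apply) simp
qed

text \<open>\<open>crash i = None\<close> means that robot \<open>i\<close> never crashes; \<open>crash i = Some c\<close> means that it takes
  no step at any time \<open>t \<ge> c\<close>.\<close>

definition crashed :: "(nat \<Rightarrow> nat option) \<Rightarrow> nat \<Rightarrow> nat \<Rightarrow> bool" where
  "crashed crash i t \<longleftrightarrow> (\<exists>c. crash i = Some c \<and> c \<le> t)"

definition faulty :: "nat \<Rightarrow> (nat \<Rightarrow> nat option) \<Rightarrow> nat set" where
  "faulty n crash = {i. i < n \<and> crash i \<noteq> None}"

definition fair_schedule :: "nat \<Rightarrow> (nat \<Rightarrow> nat set) \<Rightarrow> bool" where
  "fair_schedule n act \<longleftrightarrow> (\<forall>i<n. \<exists>\<^sub>\<infinity>t. i \<in> act t)"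

text \<open>\<open>f i\<close> is the target function of robot \<open>i\<close>, and \<open>u i\<close>, \<open>A i\<close> are the unit length and axes
  of its local coordinate system. The observed multiset contains the origin, so
  \<open>f i\<close> does not return \<open>None\<close> and every initial configuration has an execution.\<close>

definition execution ::
  "nat \<Rightarrow> (nat \<Rightarrow> target) \<Rightarrow> (nat \<Rightarrow> real) \<Rightarrow> (nat \<Rightarrow> real ^ 2 ^ 2) \<Rightarrow>
   (nat \<Rightarrow> nat set) \<Rightarrow> (nat \<Rightarrow> nat option) \<Rightarrow> (nat \<Rightarrow> nat \<Rightarrow> point) \<Rightarrow> bool" where
  "execution n f u A act crash x \<longleftrightarrow>
     (\<forall>t. \<forall>i<n.
        (let \<gamma> = to_global (x t i) (u i) (A i) in
         if i \<in> act t \<and> \<not> crashed crash i t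
         then Some (x (Suc t) i) =
              map_option \<gamma> (f i (image_mset (inv \<gamma>) (configuration n (x t))))
         else x (Suc t) i = x t i))"

lemma target_local_view_not_None:
  assumes "target_function \<phi>" "i < n" "u > 0" "rotation_matrix A"
  shows "\<phi> (image_mset (inv (to_global (x i) u A)) (configuration n x)) \<noteq> None"
proof -
  let ?P = "image_mset (inv (to_global (x i) u A)) (configuration n x)"
  have "to_global (x i) u A 0 = x i" by (simp add: to_global_def)
  then have "inv (to_global (x i) u A) (x i) = 0"
    using bij_to_global[OF assms(3,4)] by (metis bij_inv_eq_iff)
  then have "0 \<in># ?P"
    using assms(2) unfolding configuration_def by (simp add: image_image)
  then show ?thesis
    using assms(1) unfolding target_function_def by (metis empty_not_add_mset mset_add)
qed

definition compatible_FC1_PO :: "target set \<Rightarrow> bool" where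
  "compatible_FC1_PO \<Phi> \<longleftrightarrow>
     (\<forall>n f u A act crash x.
        n \<ge> 2 \<longrightarrow>
        (\<forall>i<n. f i \<in> \<Phi>) \<longrightarrow>
        (\<forall>i<n. u i > 0 \<and> rotation_matrix (A i)) \<longrightarrow>
        fair_schedule n act \<longrightarrow>
        card (faulty n crash) \<le> 1 \<longrightarrow>
        execution n f u A act crash x \<longrightarrow>
        (\<exists>c. \<forall>i<n. (\<lambda>t. x t i) \<longlonglongrightarrow> c))"

end

(* Every move lands in d * CH(P) with d \<le> a < 1, and this can be tested one coordinate at a time.
   Along a coordinate, let M and m be the limits of the nonincreasing maximum and of the
   nondecreasing minimum over the robots. A moving robot keeps the distance (1 - a)(M - m) / n from
   the current maximum and minimum, because the centroid does. If m < M then, from some time on,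
   every robot that has moved stays strictly between m and M. By fairness only the faulty robot can
   then attain the maximum or the minimum; being a single robot, it cannot attain both. *)

theory Submission
  imports Defs
begin

text \<open>The behaviour of a single coordinate, without geometry: \<open>moved t i\<close> stands
  for an activation that takes effect, and \<open>F\<close>, with at most one element, for the
  faulty robots. The premises on \<open>L\<close> and \<open>U\<close> force them to be the minimum
  and maximum at time \<open>t\<close>.\<close>

lemma contracting_moves_common_limit:
  fixes y :: "nat \<Rightarrow> nat \<Rightarrow> real" and c :: real
  assumes n: "n > 0" and c: "c > 0"
    and step: "\<And>t i. i < n \<Longrightarrow> y (Suc t) i = y t i \<or> moved t i"
    and moved: "\<And>t i L U. i < n \<Longrightarrow> moved t i \<Longrightarrow> (\<And>j. j < n \<Longrightarrow> y t j \<in> {L..U}) \<Longrightarrow>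
      L \<in> y t ` {..<n} \<Longrightarrow> U \<in> y t ` {..<n} \<Longrightarrow>
      y (Suc t) i \<in> {L + c * (U - L)..U - c * (U - L)}"
    and fair: "\<And>i. i < n \<Longrightarrow> i \<notin> F \<Longrightarrow> \<exists>\<^sub>\<infinity>t. moved t i"
    and F: "\<And>i j. i \<in> F \<Longrightarrow> j \<in> F \<Longrightarrow> i = j"
  shows "\<exists>l. \<forall>i<n. (\<lambda>t. y t i) \<longlonglongrightarrow> l"
proof -
  define Mx where "Mx t = Max (y t ` {..<n})" for t
  define Mn where "Mn t = Min (y t ` {..<n})" for t
  have ne: "y t ` {..<n} \<noteq> {}" for t using n by auto
  have Mx_in: "Mx t \<in> y t ` {..<n}" and Mn_in: "Mn t \<in> y t ` {..<n}" for t
    unfolding Mx_def Mn_def using ne by (auto intro!: Max_in Min_in)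
  have between: "y t i \<in> {Mn t..Mx t}" if "i < n" for t i
    unfolding Mx_def Mn_def using that by auto
  have le: "Mn t \<le> Mx t" for t using between[OF n, of t] by simp
  have moved_to: "y (Suc t) i \<in> {Mn t + c * (Mx t - Mn t)..Mx t - c * (Mx t - Mn t)}"
    if "i < n" "moved t i" for t i
    using moved[OF that between] Mx_in Mn_in by blast
  have suc: "y (Suc t) i \<in> {Mn t..Mx t}" if "i < n" for t i
  proof -
    have "c * (Mx t - Mn t) \<ge> 0" using c le[of t] by simp
    then show ?thesis using step[OF that, of t] between[OF that, of t] moved_to[OF that, of t] by auto
  qed
  have dec: "decseq Mx"
  proof (rule decseq_SucI)
    show "Mx (Suc t) \<le> Mx t" for t using Mx_in[of "Suc t"] suc by auto
  qed
  have inc: "incseq Mn"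
  proof (rule incseq_SucI)
    show "Mn t \<le> Mn (Suc t)" for t using Mn_in[of "Suc t"] suc by auto
  qed
  have bounded: "Mn 0 \<le> Mx t" "Mn t \<le> Mx 0" for t
    using incseqD[OF inc, of 0 t] decseqD[OF dec, of 0 t] le[of t] by auto
  obtain M where M: "Mx \<longlonglongrightarrow> M" "\<And>t. M \<le> Mx t"
    using decseq_convergent[OF dec, of "Mn 0"] bounded(1) by blast
  obtain m where m: "Mn \<longlonglongrightarrow> m" "\<And>t. Mn t \<le> m"
    using incseq_convergent[OF inc, of "Mx 0"] bounded(2) by blast
  have mM: "m \<le> M" using LIMSEQ_le[OF m(1) M(1)] le by blast
  have "M = m"
  proof (rule ccontr)
    assume "M \<noteq> m"
    with mM have "m < M" by simp
    \<comment> \<open>The current range is never shorter than \<open>M - m\<close>, so every move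
      ends at least \<open>\<delta>\<close> inside it. Once both extremes are within
      \<open>\<delta>\<close> of their limits, a move lands strictly between \<open>m\<close> and
      \<open>M\<close>.\<close>
    define \<delta> where "\<delta> = c * (M - m)"
    have "\<delta> > 0" using c \<open>m < M\<close> by (simp add: \<delta>_def)
    then have "\<forall>\<^sub>F t in sequentially. Mx t < M + \<delta> \<and> Mn t > m - \<delta>"
      by (intro eventually_conj order_tendstoD(2)[OF M(1)] order_tendstoD(1)[OF m(1)]) auto
    then obtain T where T: "\<And>t. t \<ge> T \<Longrightarrow> Mx t < M + \<delta> \<and> Mn t > m - \<delta>"
      by (auto simp: eventually_sequentially)
    have inner: "y (Suc t) i \<in> {m<..<M}" if "i < n" "moved t i" "t \<ge> T" for t i
    proof -
      have "\<delta> \<le> c * (Mx t - Mn t)"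
        unfolding \<delta>_def using c M(2)[of t] m(2)[of t] by (intro mult_left_mono) auto
      then show ?thesis using moved_to[OF that(1,2)] T[OF that(3)] by auto
    qed
    have stays: "\<exists>s0. \<forall>s\<ge>s0. y s i \<in> {m<..<M}" if i: "i < n" "i \<notin> F" for i
    proof -
      \<comment> \<open>One late move brings the robot inside; each later step either keeps its
        value or is another late move.\<close>
      obtain t where t: "t \<ge> T" "moved t i"
        using fair[OF i] by (auto simp: INFM_nat_le)
      have "y s i \<in> {m<..<M}" if "Suc t \<le> s" for s
        using that
      proof (induction s rule: dec_induct)
        case base
        show ?case using inner[OF i(1) t(2,1)] .
      next
        case (step s)
        then have "s \<ge> T" using t(1) by simp
        \<comment> \<open>\<open>assms(3)\<close> is the hypothesis \<open>step\<close>, whose name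
          the induction case shadows.\<close>
        then show ?case using assms(3)[OF i(1), of s] inner[OF i(1), of s] step.IH by auto
      qed
      then show ?thesis by blast
    qed
    then obtain S where S: "\<And>i s. i < n \<Longrightarrow> i \<notin> F \<Longrightarrow> s \<ge> S i \<Longrightarrow> y s i \<in> {m<..<M}"
      by metis
    \<comment> \<open>The values of \<open>S\<close> on \<open>F\<close> are arbitrary; including
      them in the maximum can only delay \<open>s\<close>.\<close>
    define s where "s = Max (S ` {..<n})"
    have s: "S i \<le> s" if "i < n" for i unfolding s_def using that by simp
    obtain i where i: "i < n" "y s i = Mx s" using Mx_in[of s] by auto
    obtain j where j: "j < n" "y s j = Mn s" using Mn_in[of s] by auto
    have "i \<in> F" using S[OF i(1) _ s[OF i(1)]] i(2) M(2)[of s] by force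
    moreover have "j \<in> F" using S[OF j(1) _ s[OF j(1)]] j(2) m(2)[of s] by force
    ultimately have "Mx s = Mn s" using F i j by metis
    then show False using M(2)[of s] m(2)[of s] \<open>m < M\<close> by simp
  qed
  have "(\<lambda>t. y t i) \<longlonglongrightarrow> m" if "i < n" for i
  proof (rule tendsto_sandwich[OF _ _ m(1)])
    show "\<forall>\<^sub>F t in sequentially. Mn t \<le> y t i" "\<forall>\<^sub>F t in sequentially. y t i \<le> Mx t"
      using between[OF that] by simp_all
    show "Mx \<longlonglongrightarrow> m" using M(1) \<open>M = m\<close> by simp
  qed
  then show ?thesis by blast
qed

text \<open>Affine maps commute with means. The empty multiset is excluded because its centroid is
  the junk value 0, which a translation need not fix.\<close>

lemma to_global_centroid:
  assumes "Q \<noteq> {#}"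
  shows "to_global p u A (centroid Q) = centroid (image_mset (to_global p u A) Q)"
proof -
  have "(\<Sum>q\<in>#Q. to_global p u A q) = real (size Q) *\<^sub>R p + u *\<^sub>R (A *v \<Sum>\<^sub># Q)" for Q
    by (induction Q) (simp_all add: to_global_def algebra_simps matrix_vector_right_distrib)
  moreover have "size Q \<noteq> 0" using assms by simp
  ultimately show ?thesis
    by (simp add: centroid_def to_global_def[of p u A "(1 / _) *\<^sub>R _"]
        matrix_vector_mult_scaleR scaleR_add_right)
qed

lemma to_global_CH:
  "CH (image_mset (to_global p u A) Q) = to_global p u A ` CH Q"
proof -
  have lin: "linear (\<lambda>z. u *\<^sub>R (A *v z))"
    by (rule linear_compose_scale_right) simp
  have "to_global p u A ` S = (\<lambda>x. p + x) ` (\<lambda>z. u *\<^sub>R (A *v z)) ` S" for S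
    by (simp add: image_image to_global_def)
  then show ?thesis
    by (simp only: CH_def set_image_mset convex_hull_translation
        convex_hull_linear_image[OF lin])
qed

text \<open>The weights \<open>d\<close> and \<open>1 - d\<close> sum to 1, so the affine map passes
  through the combination. Hence a scale bound in a local view is valid in global
  coordinates.\<close>

lemma to_global_scaled_CH:
  assumes "Q \<noteq> {#}" "z \<in> scaled_CH d Q"
  shows "to_global p u A z \<in> scaled_CH d (image_mset (to_global p u A) Q)"
proof -
  obtain w where w: "w \<in> CH Q" "z = d *\<^sub>R w + (1 - d) *\<^sub>R centroid Q"
    using assms(2) by (auto simp: scaled_CH_def)
  have "to_global p u A z = d *\<^sub>R to_global p u A w + (1 - d) *\<^sub>R to_global p u A (centroid Q)"
    by (simp add: w(2) to_global_def matrix_vector_right_distrib matrix_vector_mult_scaleR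
        algebra_simps)
  then show ?thesis
    using w(1) by (auto simp: scaled_CH_def to_global_CH to_global_centroid[OF assms(1)])
qed

text \<open>A single robot at the low value \<open>L\<close> pulls the mean down to at most
  \<open>U - (U - L) / n\<close>, and the centroid has weight \<open>1 - d \<ge> 1 - a\<close> in
  \<open>z\<close>. The bound from below follows by replacing \<open>b\<close> with
  \<open>-b\<close>.\<close>

lemma scaled_CH_inner_le:
  assumes n: "n > 0" and d: "0 \<le> d" "d \<le> a" "a < 1"
    and z: "z \<in> scaled_CH d (configuration n x)"
    and bounds: "\<And>j. j < n \<Longrightarrow> L \<le> x j \<bullet> b \<and> x j \<bullet> b \<le> U"
    and L: "i < n" "x i \<bullet> b = L"
  shows "z \<bullet> b \<le> U - (1 - a) / n * (U - L)"
proof -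
  obtain w where w: "w \<in> convex hull (x ` {..<n})"
    "z = d *\<^sub>R w + (1 - d) *\<^sub>R centroid (configuration n x)"
    using z by (auto simp: scaled_CH_def CH_def configuration_def)
  have "convex hull (x ` {..<n}) \<subseteq> {v. v \<bullet> b \<le> U}"
    using bounds convex_halfspace_le[of b U]
    by (intro hull_minimal) (auto simp: inner_commute)
  then have wU: "w \<bullet> b \<le> U" using w(1) by blast
  have "(\<Sum>j<n. x j \<bullet> b) = L + (\<Sum>j\<in>{..<n} - {i}. x j \<bullet> b)"
    using L by (simp add: sum.remove)
  also have "\<dots> \<le> L + (\<Sum>j\<in>{..<n} - {i}. U)"
    using bounds by (intro add_left_mono sum_mono) auto
  also have "\<dots> = n * U - (U - L)"
    using L n by (simp add: of_nat_diff algebra_simps)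
  finally have "centroid (configuration n x) \<bullet> b \<le> (n * U - (U - L)) / n"
    using n by (simp add: centroid_def configuration_def sum_unfold_sum_mset[symmetric]
        inner_sum_left divide_right_mono)
  then have g: "centroid (configuration n x) \<bullet> b \<le> U - (U - L) / n"
    using n by (simp add: diff_divide_distrib)
  have "z \<bullet> b = d * (w \<bullet> b) + (1 - d) * (centroid (configuration n x) \<bullet> b)"
    by (simp add: w(2) inner_add_left)
  also have "\<dots> \<le> d * U + (1 - d) * (U - (U - L) / n)"
    using wU g d by (intro add_mono mult_left_mono) auto
  also have "\<dots> = U - (1 - d) * ((U - L) / n)" by (simp add: algebra_simps)
  \<comment> \<open>Passing from \<open>d\<close> to \<open>a\<close> uses \<open>L \<le> U\<close>,
    which \<open>bounds\<close> gives at robot \<open>i\<close>.\<close>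
  also have "\<dots> \<le> U - (1 - a) * ((U - L) / n)"
    using d bounds[OF L(1)] by (intro diff_left_mono mult_right_mono) auto
  finally show ?thesis by simp
qed

text \<open>A real bound on the supremum rules out the value \<open>\<infinity>\<close> at
  \<open>P\<close>, and the least \<open>d\<close> is attained, so it is itself the witness.\<close>

lemma scale_set_le_in_scaled_CH:
  assumes "\<phi> \<in> \<Phi>" "scale_set \<Phi> \<le> ereal a" "P \<noteq> {#}" "\<phi> P = Some z"
  shows "\<exists>d. 0 \<le> d \<and> d \<le> a \<and> z \<in> scaled_CH d P"
proof -
  have "scale_at \<phi> P \<le> scale \<phi>"
    unfolding scale_def using assms(3) by (intro SUP_upper) auto
  also have "\<dots> \<le> scale_set \<Phi>"
    unfolding scale_set_def using assms(1) by (rule SUP_upper)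
  finally have le: "scale_at \<phi> P \<le> ereal a" using assms(2) by (rule order_trans)
  then have "\<exists>d\<ge>0. z \<in> scaled_CH d P"
    using assms(4) by (auto simp: scale_at_def split: if_splits)
  then show ?thesis
    using scale_at_attained[of \<phi> P z] assms(4) le by fastforce
qed

lemma execution_move_in_scaled_CH:
  assumes ex: "execution n f u A act crash x"
    and i: "i < n" "i \<in> act t" "\<not> crashed crash i t"
    and frame: "u i > 0" "rotation_matrix (A i)"
    and \<Phi>: "f i \<in> \<Phi>" "scale_set \<Phi> \<le> ereal a"
  shows "\<exists>d. 0 \<le> d \<and> d \<le> a \<and> x (Suc t) i \<in> scaled_CH d (configuration n (x t))"
proof -
  let ?\<gamma> = "to_global (x t i) (u i) (A i)"
  let ?Q = "image_mset (inv ?\<gamma>) (configuration n (x t))"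
  have Q: "?Q \<noteq> {#}" using i(1) by (auto simp: configuration_def mset_set_empty_iff)
  \<comment> \<open>Surjectivity of \<open>?\<gamma>\<close> makes it undo
    \<open>inv ?\<gamma>\<close>, so pushing the local view forward recovers the true
    configuration.\<close>
  have img: "image_mset ?\<gamma> ?Q = configuration n (x t)"
    using bij_to_global[OF frame]
    by (simp add: multiset.map_comp comp_def surj_f_inv_f bij_is_surj)
  have "Some (x (Suc t) i) = map_option ?\<gamma> (f i ?Q)"
    using ex i by (auto simp: execution_def Let_def)
  then obtain z where z: "f i ?Q = Some z" "x (Suc t) i = ?\<gamma> z"
    by (cases "f i ?Q") auto
  obtain d where "0 \<le> d" "d \<le> a" "z \<in> scaled_CH d ?Q"
    using scale_set_le_in_scaled_CH[OF \<Phi> Q z(1)] by blast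
  then show ?thesis
    using to_global_scaled_CH[OF Q] z(2) img by metis
qed

theorem theorem4:
  fixes \<Phi> :: "target set"
  assumes "\<Phi> \<noteq> {}"
    and "\<And>\<phi>. \<phi> \<in> \<Phi> \<Longrightarrow> target_function \<phi>"
    and "0 \<le> scale_set \<Phi>" and "scale_set \<Phi> < 1"
  shows "compatible_FC1_PO \<Phi>"
  unfolding compatible_FC1_PO_def
proof (intro allI impI)
  fix n f u A act crash x
  assume n: "2 \<le> (n::nat)" and f: "\<forall>i<n. f i \<in> \<Phi>"
    and frames: "\<forall>i<n. u i > 0 \<and> rotation_matrix (A i)"
    and fair: "fair_schedule n act" and faulty: "card (faulty n crash) \<le> 1"
    and ex: "execution n f u A act crash x"
  \<comment> \<open>The lower bound 0 excludes \<open>-\<infinity>\<close> and the upper bound 1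
    excludes \<open>\<infinity>\<close>, so the scale is a real number.\<close>
  obtain a where a: "scale_set \<Phi> = ereal a" "a < 1"
    using assms(3,4) by (cases "scale_set \<Phi>") auto
  have n0: "n > 0" using n by simp
  define moved where "moved t i \<longleftrightarrow> i \<in> act t \<and> \<not> crashed crash i t" for t i
  have coord: "\<exists>l. \<forall>i<n. (\<lambda>t. x t i $ k) \<longlonglongrightarrow> l" for k :: 2
  proof (rule contracting_moves_common_limit[where c = "(1 - a) / n" and moved = moved
        and F = "faulty n crash"])
    show "n > 0" "(1 - a) / n > 0" using n0 a(2) by auto
    show "x (Suc t) i $ k = x t i $ k \<or> moved t i" if "i < n" for t i
      using ex that unfolding execution_def moved_def Let_def by metis
    show "\<exists>\<^sub>\<infinity>t. moved t i" if "i < n" "i \<notin> faulty n crash" for i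
      using that fair by (auto simp: fair_schedule_def moved_def crashed_def faulty_def)
    have "finite (faulty n crash)" by (simp add: faulty_def)
    then show "i = j" if "i \<in> faulty n crash" "j \<in> faulty n crash" for i j
      using faulty that by (auto simp: card_le_Suc0_iff_eq)
  next
    fix t i L U
    assume i: "i < n" "moved t i" and bounds: "\<And>j. j < n \<Longrightarrow> x t j $ k \<in> {L..U}"
      and LU: "L \<in> (\<lambda>i. x t i $ k) ` {..<n}" "U \<in> (\<lambda>i. x t i $ k) ` {..<n}"
    obtain d where d: "0 \<le> d" "d \<le> a" "x (Suc t) i \<in> scaled_CH d (configuration n (x t))"
      using execution_move_in_scaled_CH[OF ex] i frames f a(1) by (metis moved_def order_refl)
    obtain p q where pq: "p < n" "x t p $ k = L" "q < n" "x t q $ k = U" using LU by auto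
    have "x (Suc t) i \<bullet> axis k 1 \<le> U - (1 - a) / n * (U - L)"
      using scaled_CH_inner_le[OF n0 d(1,2) a(2) d(3), of L "axis k 1" U p] bounds pq
      by (simp add: inner_axis)
    \<comment> \<open>In the reversed direction the maximum is \<open>- L\<close> and the minimum
      \<open>- U\<close>, attained at \<open>q\<close>.\<close>
    moreover have "x (Suc t) i \<bullet> - axis k 1 \<le> - L - (1 - a) / n * (- L - (- U))"
      using scaled_CH_inner_le[OF n0 d(1,2) a(2) d(3), of "- U" "- axis k 1" "- L" q] bounds pq
      by (simp add: inner_axis)
    ultimately show "x (Suc t) i $ k \<in> {L + (1 - a) / n * (U - L)..U - (1 - a) / n * (U - L)}"
      by (simp add: inner_axis)
  qed
  \<comment> \<open>The limit \<open>l k\<close> depends on the coordinate but not on the robot, so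
    the coordinate limits assemble into one common point.\<close>
  then obtain l where l: "\<And>k i. i < n \<Longrightarrow> (\<lambda>t. x t i $ k) \<longlonglongrightarrow> l k" by metis
  then have "(\<lambda>t. x t i) \<longlonglongrightarrow> vec_lambda l" if "i < n" for i
    using that by (intro vec_tendstoI) simp
  then show "\<exists>c. \<forall>i<n. (\<lambda>t. x t i) \<longlonglongrightarrow> c" by blast
qed

end
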